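(* Let $\lambda\in\mathbb{R}$, let $x,y,z\in\mathbb{C}$ with $z\ne0$, and let $f_{\lambda}(t)=\sum_{k=0}^{\infty}a_{k}(t)_{k,\lambda}$ be a degenerate formal power series. Then $$\sum_{n=0}^{\infty}x^{n}\bigg\{\sum_{k=0}^{n}\binom{n}{k}(-1)^{k}f_{\lambda}(y+zk)\bigg\}= \sum_{m=0}^{\infty}a_{m}\sum_{p=0}^{m}\binom{m}{p}(y)_{m-p,\lambda}z^{p}F_{p,\frac{\lambda}{z}}(-x).$$ In particular, for $y=0$, $$\sum_{n=0}^{\infty}x^{n}\bigg\{\sum_{k=0}^{n}\binom{n}{k}(-1)^{k}f_{\lambda}(zk)\bigg\}= \sum_{m=0}^{\infty}a_{m}z^{m}F_{m,\frac{\lambda}{z}}(-x).$$ Both identities are understood formally in the coefficients $a_m$, i.e. for each $m\ge 0$ the coefficients of $a_m$ on the two sides are equal.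
   Context: For a complex number $\mu$, the $\mu$-falling factorials are $(x)_{0,\mu}=1$ and $(x)_{n,\mu}=x(x-\mu)(x-2\mu)\cdots(x-(n-1)\mu)$ for $n\ge1$. The degenerate exponential is the formal power series $e_{\mu}(t)=\sum_{n=0}^{\infty}\frac{(1)_{n,\mu}}{n!}t^{n}$. The degenerate Fubini polynomials $F_{n,\mu}(x)$ are defined by $\frac{1}{1-x(e_{\mu}(t)-1)}=\sum_{n=0}^{\infty}F_{n,\mu}(x)\frac{t^{n}}{n!}$. A degenerate formal power series is an expression $f_{\lambda}(t)=\sum_{k=0}^{\infty}a_{k}(t)_{k,\lambda}$ with coefficients $a_0,a_1,a_2,\dots$; for a number $w$, $f_\lambda(w)$ denotes the formal sum $\sum_{m=0}^{\infty}a_m (w)_{m,\lambda}$. Each side of an identity is regarded as a formal linear combination $\sum_{m\ge0}a_m c_m$ with $c_m\in\mathbb{C}$; the outer sum over $n$ is carried out coefficientwise in the $a_m$ (for each $m$, the coefficient of $a_m$ in the inner braces vanishes for $n>m$, so only finitely many $n$ contribute). Convention: $x^0=1$. *)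

theory Defs
  imports Complex_Main "HOL-Computational_Algebra.Formal_Power_Series"
begin

text \<open>\<open>dfall \<mu> n x\<close> is the falling factorial \<open>x (x - \<mu>) \<dots> (x - (n - 1) \<mu>)\<close>.\<close>

definition dfall :: "complex \<Rightarrow> nat \<Rightarrow> complex \<Rightarrow> complex" where
  "dfall \<mu> n x = (\<Prod>i<n. x - of_nat i * \<mu>)"

definition dexp :: "complex \<Rightarrow> complex fps" where
  "dexp \<mu> = Abs_fps (\<lambda>n. dfall \<mu> n 1 / fact n)"

text \<open>\<open>dfubini \<mu> n x\<close> is the value at \<open>x\<close> of the \<open>n\<close>-th degenerate Fubini polynomial. The series
  being inverted has constant coefficient 1, so \<open>inverse\<close> is its genuine multiplicative inverse.\<close>

definition dfubini :: "complex \<Rightarrow> nat \<Rightarrow> complex \<Rightarrow> complex" where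
  "dfubini \<mu> n x = fact n * fps_nth (inverse (1 - fps_const x * (dexp \<mu> - 1))) n"

lemma dfubini_generating_function:
  "(1 - fps_const x * (dexp \<mu> - 1)) * Abs_fps (\<lambda>n. dfubini \<mu> n x / fact n) = 1"
proof -
  have "fps_nth (1 - fps_const x * (dexp \<mu> - 1)) 0 \<noteq> 0"
    by (simp add: dexp_def dfall_def)
  moreover have "Abs_fps (\<lambda>n. dfubini \<mu> n x / fact n) = inverse (1 - fps_const x * (dexp \<mu> - 1))"
    by (simp add: fps_eq_iff dfubini_def)
  ultimately show ?thesis
    by (metis inverse_mult_eq_1')
qed

text \<open>A formal sum is represented by a function of the index \<open>m\<close>, and two formal sums are equal iff
  they agree at every \<open>m\<close>; no convergence in \<open>m\<close> is involved. For given complex coefficients \<open>a\<close>,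
  the formal sum \<open>\<Sum>m. a m * dfall \<mu> m w\<close> is represented by its terms.\<close>

definition dfps_eval :: "(nat \<Rightarrow> complex) \<Rightarrow> complex \<Rightarrow> complex \<Rightarrow> nat \<Rightarrow> complex" where
  "dfps_eval a \<mu> w = (\<lambda>m. a m * dfall \<mu> m w)"

text \<open>For indeterminate coefficients \<open>a\<^sub>0, a\<^sub>1, \<dots>\<close>, a formal linear combination \<open>\<Sum>m. a\<^sub>m c\<^sub>m\<close>
  is represented by the sequence \<open>c\<close> of the coefficients of the \<open>a\<^sub>m\<close>; the value at \<open>w\<close> of the
  series with these coefficients is then as follows.\<close>

definition generic_dfps_eval :: "complex \<Rightarrow> complex \<Rightarrow> nat \<Rightarrow> complex" where
  "generic_dfps_eval \<mu> w = (\<lambda>m. dfall \<mu> m w)"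

text \<open>\<open>g n\<close> is the \<open>n\<close>-th summand. The sum over \<open>n\<close> is taken separately at each \<open>m\<close>, where only
  finitely many \<open>n\<close> may contribute.\<close>

definition has_formal_sum :: "(nat \<Rightarrow> nat \<Rightarrow> complex) \<Rightarrow> (nat \<Rightarrow> complex) \<Rightarrow> bool" where
  "has_formal_sum g s \<longleftrightarrow>
     (\<forall>m. finite {n. g n m \<noteq> 0} \<and> (\<Sum>n | g n m \<noteq> 0. g n m) = s m)"

end

theory Submission imports Defs begin

text \<open>
  Write \<open>e\<^sub>\<lambda>\<^sup>w(t)\<close> for the series with coefficients \<open>(w)\<^sub>m\<^sub>,\<^sub>\<lambda> / m!\<close>, which is the binomial
  series of \<open>(1 + \<lambda>t)\<^bsup>w/\<lambda>\<^esup>\<close> if \<open>\<lambda> \<noteq> 0\<close> and \<open>exp (w t)\<close> if \<open>\<lambda> = 0\<close>.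
  The coefficient of \<open>a\<^sub>m\<close> in \<open>f\<^sub>\<lambda>(w)\<close> is \<open>m!\<close> times the coefficient of \<open>t\<^sup>m\<close>
  in \<open>e\<^sub>\<lambda>\<^sup>w\<close>, so both sides of the identity are exponential generating functions in \<open>t\<close>, with the
  index \<open>m\<close> of \<open>a\<^sub>m\<close> as the exponent. The law of exponents \<open>dexp_pow_add\<close> and the binomial theorem
  turn the inner braces into \<open>e\<^sub>\<lambda>\<^sup>y (1 - e\<^sub>\<lambda>\<^sup>z)\<^sup>n\<close> (\<open>binomial_difference_dexp_pow\<close>). The series
  \<open>1 - e\<^sub>\<lambda>\<^sup>z\<close> has no constant term, so its \<open>n\<close>-th power only reaches exponents \<open>m \<ge> n\<close>, and summing
  over \<open>n\<close> with weights \<open>x\<^sup>n\<close> is a formal geometric series (\<open>fps_geometric_nth\<close>) with sum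
  \<open>e\<^sub>\<lambda>\<^sup>y / (1 - x (1 - e\<^sub>\<lambda>\<^sup>z))\<close>. Finally \<open>(zw)\<^sub>m\<^sub>,\<^sub>\<lambda> = z\<^sup>m (w)\<^bsub>m,\<lambda>/z\<^esub>\<close> says that \<open>e\<^sub>\<lambda>\<^sup>z(t)\<close> is
  the degenerate exponential of parameter \<open>\<lambda>/z\<close> at \<open>zt\<close>. The series
  \<open>1 / (1 - x (1 - e\<^sub>\<lambda>\<^sup>z))\<close> is thus the generating
  function of the degenerate Fubini polynomials at \<open>-x\<close> with \<open>t\<close> replaced by \<open>zt\<close>
  (\<open>inverse_dexp_pow_nth\<close>), and multiplying it by \<open>e\<^sub>\<lambda>\<^sup>y\<close> gives the right-hand side as a binomial
  convolution. The case \<open>y = 0\<close> is \<open>e\<^sub>\<lambda>\<^sup>0 = 1\<close>.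
\<close>

lemma dfall_0 [simp]: "dfall \<mu> 0 w = 1"
  by (simp add: dfall_def)

lemma dfall_Suc: "dfall \<mu> (Suc n) w = dfall \<mu> n w * (w - of_nat n * \<mu>)"
  by (simp add: dfall_def)

lemma dfall_at_0: "dfall \<mu> n 0 = (if n = 0 then 1 else 0)"
  by (induction n) (auto simp: dfall_Suc)

lemma dfall_scale:
  assumes "z \<noteq> 0"
  shows "dfall \<mu> n (z * w) = z ^ n * dfall (\<mu> / z) n w"
  by (induction n) (use assms in \<open>simp_all add: dfall_Suc field_simps\<close>)

definition dexp_pow :: "complex \<Rightarrow> complex \<Rightarrow> complex fps" where
  "dexp_pow \<mu> w = Abs_fps (\<lambda>n. dfall \<mu> n w / fact n)"

lemma dexp_pow_nth [simp]: "fps_nth (dexp_pow \<mu> w) n = dfall \<mu> n w / fact n"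
  by (simp add: dexp_pow_def)

lemma dexp_pow_0 [simp]: "dexp_pow \<mu> 0 = 1"
  by (simp add: fps_eq_iff dfall_at_0)

text \<open>The recursion of the falling factorials is not directly compatible with the convolution in a
  product of two series. The equivalent differential equation is, by the product rule.\<close>

lemma dexp_pow_ode_iff:
  fixes F :: "'a :: comm_ring_1 fps"
  shows "(1 + fps_const \<mu> * fps_X) * fps_deriv F = fps_const w * F \<longleftrightarrow>
    (\<forall>n. of_nat (Suc n) * fps_nth F (Suc n) = (w - of_nat n * \<mu>) * fps_nth F n)"
proof -
  have "fps_nth ((1 + fps_const \<mu> * fps_X) * fps_deriv F) n =
      of_nat (Suc n) * fps_nth F (Suc n) + of_nat n * \<mu> * fps_nth F n" for n
    by (cases n) (simp_all add: distrib_right mult.assoc, simp add: algebra_simps)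
  then show ?thesis
    unfolding fps_eq_iff by (simp add: left_diff_distrib eq_diff_eq del: of_nat_Suc)
qed

lemma dexp_pow_ode:
  "(1 + fps_const \<mu> * fps_X) * fps_deriv (dexp_pow \<mu> w) = fps_const w * dexp_pow \<mu> w"
  unfolding dexp_pow_ode_iff by (simp add: dfall_Suc fact_Suc mult_ac del: of_nat_Suc)

lemma dexp_pow_unique:
  assumes ode: "(1 + fps_const \<mu> * fps_X) * fps_deriv F = fps_const w * F"
    and init: "fps_nth F 0 = 1"
  shows "F = dexp_pow \<mu> w"
proof (rule fps_ext)
  show "fps_nth F n = fps_nth (dexp_pow \<mu> w) n" for n
  proof (induction n)
    case 0
    show ?case by (simp add: init)
  next
    case (Suc n)
    have "of_nat (Suc n) * fps_nth F (Suc n) = (w - of_nat n * \<mu>) * fps_nth F n"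
      using ode unfolding dexp_pow_ode_iff by blast
    also have "\<dots> = of_nat (Suc n) * fps_nth (dexp_pow \<mu> w) (Suc n)"
      using dexp_pow_ode[of \<mu> w] unfolding dexp_pow_ode_iff Suc.IH by metis
    finally show ?case
      by (metis mult_left_cancel of_nat_neq_0)
  qed
qed

text \<open>The product of the solutions of the differential equations for \<open>v\<close> and \<open>w\<close> solves the one
  for \<open>v + w\<close>.\<close>

lemma dexp_pow_add: "dexp_pow \<mu> (v + w) = dexp_pow \<mu> v * dexp_pow \<mu> w"
proof -
  let ?L = "1 + fps_const \<mu> * fps_X" and ?A = "dexp_pow \<mu> v" and ?B = "dexp_pow \<mu> w"
  have "?L * fps_deriv (?A * ?B) = (?L * fps_deriv ?A) * ?B + ?A * (?L * fps_deriv ?B)"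
    by (simp add: algebra_simps)
  also have "\<dots> = fps_const (v + w) * (?A * ?B)"
    unfolding dexp_pow_ode by (simp add: algebra_simps flip: fps_const_add)
  finally show ?thesis
    by (intro dexp_pow_unique[symmetric]) simp_all
qed

lemma dexp_pow_of_nat: "dexp_pow \<mu> (z * of_nat k) = dexp_pow \<mu> z ^ k"
  by (induction k) (simp_all add: distrib_left dexp_pow_add)

lemma binomial_difference_dexp_pow:
  "(\<Sum>k=0..n. of_nat (n choose k) * (-1) ^ k * dexp_pow \<mu> (y + z * of_nat k)) =
     dexp_pow \<mu> y * (1 - dexp_pow \<mu> z) ^ n"
proof -
  have "(1 - dexp_pow \<mu> z) ^ n =
      (\<Sum>k\<le>n. of_nat (n choose k) * (- dexp_pow \<mu> z) ^ k)"
    using binomial_ring[of "- dexp_pow \<mu> z" 1 n] by simp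
  also have "\<dots> = (\<Sum>k=0..n. of_nat (n choose k) * (-1) ^ k * dexp_pow \<mu> z ^ k)"
    by (intro sum.cong) (auto simp: power_minus[of "dexp_pow \<mu> z"] mult_ac atLeast0AtMost)
  finally show ?thesis
    by (simp add: dexp_pow_add dexp_pow_of_nat sum_distrib_left mult_ac)
qed

lemma binomial_difference_dfall:
  "(\<Sum>k=0..n. of_nat (n choose k) * (-1) ^ k * dfall \<mu> m (y + z * of_nat k)) =
     fact m * fps_nth (dexp_pow \<mu> y * (1 - dexp_pow \<mu> z) ^ n) m"
proof -
  \<comment> \<open>The scalar factor has to be a constant series for coefficient extraction to be linear in it.\<close>
  have scalar: "of_nat (n choose k) * (-1) ^ k = fps_const (of_nat (n choose k) * (-1 :: complex) ^ k)"
    for k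
    by (simp add: fps_of_nat flip: fps_const_mult fps_const_power fps_const_neg)
  show ?thesis
    unfolding binomial_difference_dexp_pow[symmetric] scalar
    by (simp add: fps_sum_nth sum_distrib_left)
qed

lemma fps_nth_mult_power_eq_0:
  fixes F U :: "'a :: comm_ring_1 fps"
  assumes "fps_nth U 0 = 0" "m < n"
  shows "fps_nth (F * U ^ n) m = 0"
  using startsby_zero_power_prefix[OF assms(1)] assms(2)
  by (auto simp: fps_mult_nth intro!: sum.neutral)

text \<open>The finite geometric sum up to \<open>m\<close> differs from \<open>F / (1 - U)\<close> by a multiple of
  \<open>U\<^sup>m\<^sup>+\<^sup>1\<close>, which does not reach exponent \<open>m\<close>.\<close>

lemma fps_geometric_nth:
  fixes F U :: "'a :: field fps"
  assumes "fps_nth U 0 = 0"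
  shows "(\<Sum>n\<le>m. fps_nth (F * U ^ n) m) = fps_nth (F * inverse (1 - U)) m"
proof -
  have inv: "inverse (1 - U) * (1 - U) = 1"
    by (rule inverse_mult_eq_1) (simp add: assms)
  have "(1 - U) * (\<Sum>n\<le>m. U ^ n) = 1 - U ^ Suc m"
    using sum_gp_basic[of U m] .
  then have "inverse (1 - U) * (1 - U) * (\<Sum>n\<le>m. U ^ n) = inverse (1 - U) * (1 - U ^ Suc m)"
    by (simp only: mult.assoc)
  then have "(\<Sum>n\<le>m. U ^ n) = inverse (1 - U) * (1 - U ^ Suc m)"
    by (simp only: inv mult_1_left)
  then have "F * (\<Sum>n\<le>m. U ^ n) = F * inverse (1 - U) - F * inverse (1 - U) * U ^ Suc m"
    by (simp only: right_diff_distrib mult.assoc mult_1_right)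
  moreover have "(\<Sum>n\<le>m. fps_nth (F * U ^ n) m) = fps_nth (F * (\<Sum>n\<le>m. U ^ n)) m"
    by (simp add: sum_distrib_left fps_sum_nth)
  ultimately show ?thesis
    using fps_nth_mult_power_eq_0[OF assms, of m "Suc m" "F * inverse (1 - U)"]
    by (simp only: fps_sub_nth) simp
qed

lemma dexp_pow_eq_dexp_compose:
  assumes "z \<noteq> 0"
  shows "dexp_pow \<mu> z = dexp (\<mu> / z) oo (fps_const z * fps_X)"
  using dfall_scale[OF assms, of \<mu> _ 1]
  by (simp add: fps_eq_iff fps_compose_linear dexp_def)

lemma inverse_dexp_pow_nth:
  assumes "z \<noteq> 0"
  shows "fps_nth (inverse (1 - fps_const x * (1 - dexp_pow \<mu> z))) p =
         z ^ p * dfubini (\<mu> / z) p (- x) / fact p"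
proof -
  let ?D = "1 - fps_const (- x) * (dexp (\<mu> / z) - 1)" and ?S = "fps_const z * fps_X"
  have S0: "fps_nth ?S 0 = 0"
    by simp
  have D0: "fps_nth ?D 0 \<noteq> 0"
    by (simp add: dexp_def)
  have "1 - fps_const x * (1 - dexp_pow \<mu> z) = 1 - fps_const (- x) * (dexp_pow \<mu> z - 1)"
    by (simp add: algebra_simps flip: fps_const_neg)
  also have "\<dots> = ?D oo ?S"
    using dexp_pow_eq_dexp_compose[OF assms, of \<mu>]
    by (simp only: fps_compose_sub_distrib fps_compose_mult_distrib[OF S0] fps_compose_1 fps_const_compose)
  finally have "inverse (1 - fps_const x * (1 - dexp_pow \<mu> z)) = inverse ?D oo ?S"
    using fps_inverse_compose[OF S0 D0] by simp
  then show ?thesis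
    by (simp add: fps_compose_linear dfubini_def)
qed

lemma has_formal_sumI:
  assumes "\<And>n m. m < n \<Longrightarrow> g n m = 0" "\<And>m. (\<Sum>n\<le>m. g n m) = s m"
  shows "has_formal_sum g s"
  unfolding has_formal_sum_def
proof (intro allI conjI)
  fix m
  have sub: "{n. g n m \<noteq> 0} \<subseteq> {..m}"
    using assms(1) by (auto simp: not_le[symmetric])
  then show "finite {n. g n m \<noteq> 0}"
    by (rule finite_subset) simp
  have "(\<Sum>n | g n m \<noteq> 0. g n m) = (\<Sum>n\<le>m. g n m)"
    by (rule sum.mono_neutral_left[OF _ sub]) auto
  then show "(\<Sum>n | g n m \<noteq> 0. g n m) = s m"
    by (simp add: assms(2))
qed

text \<open>The factor \<open>c\<close> covers both readings of the identity: \<open>c = 1\<close> keeps the coefficients \<open>a\<^sub>m\<close>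
  indeterminate, and \<open>c = a\<close> gives them values.\<close>

lemma has_formal_sum_binomial_difference:
  assumes "z \<noteq> 0"
  shows "has_formal_sum
    (\<lambda>n m. x ^ n * (\<Sum>k=0..n. of_nat (n choose k) * (-1) ^ k *
        (c m * dfall \<mu> m (y + z * of_nat k))))
    (\<lambda>m. c m * (\<Sum>p=0..m. of_nat (m choose p) * dfall \<mu> (m - p) y * z ^ p *
        dfubini (\<mu> / z) p (- x)))"
    (is "has_formal_sum ?g ?s")
proof (rule has_formal_sumI)
  let ?U = "fps_const x * (1 - dexp_pow \<mu> z)"
  have U0: "fps_nth ?U 0 = 0"
    by simp
  have g: "?g n m = c m * fact m * fps_nth (dexp_pow \<mu> y * ?U ^ n) m" for n m
  proof -
    have "?g n m = c m * (x ^ n * (\<Sum>k=0..n. of_nat (n choose k) * (-1) ^ k *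
        dfall \<mu> m (y + z * of_nat k)))"
      by (simp add: sum_distrib_left mult_ac)
    also have "\<dots> = c m * fact m * (x ^ n * fps_nth (dexp_pow \<mu> y * (1 - dexp_pow \<mu> z) ^ n) m)"
      unfolding binomial_difference_dfall by (simp only: mult_ac)
    also have "x ^ n * fps_nth (dexp_pow \<mu> y * (1 - dexp_pow \<mu> z) ^ n) m =
        fps_nth (fps_const (x ^ n) * (dexp_pow \<mu> y * (1 - dexp_pow \<mu> z) ^ n)) m"
      by simp
    also have "fps_const (x ^ n) * (dexp_pow \<mu> y * (1 - dexp_pow \<mu> z) ^ n) =
        dexp_pow \<mu> y * ?U ^ n"
      by (simp add: power_mult_distrib mult_ac flip: fps_const_power)
    finally show ?thesis .
  qed
  show "?g n m = 0" if "m < n" for n m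
    unfolding g by (simp only: fps_nth_mult_power_eq_0[OF U0 that] mult_zero_right)
  show "(\<Sum>n\<le>m. ?g n m) = ?s m" for m
  proof -
    have "(\<Sum>n\<le>m. ?g n m) = c m * fact m * fps_nth (inverse (1 - ?U) * dexp_pow \<mu> y) m"
      unfolding g sum_distrib_left[symmetric] fps_geometric_nth[OF U0] by (simp only: mult.commute)
    also have "\<dots> = c m * (\<Sum>p=0..m. fact m *
        (z ^ p * dfubini (\<mu> / z) p (- x) / fact p * (dfall \<mu> (m - p) y / fact (m - p))))"
      by (simp only: fps_mult_nth inverse_dexp_pow_nth[OF assms] dexp_pow_nth
          sum_distrib_left mult.assoc)
    also have "\<dots> = ?s m"
      by (intro arg_cong[where f = "\<lambda>u. c m * u"] sum.cong)
        (auto simp: binomial_fact field_simps)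
    finally show ?thesis .
  qed
qed

theorem theorem11:
  fixes lam :: real and x y z :: complex and a :: "nat \<Rightarrow> complex"
  assumes "z \<noteq> 0"
  shows
    "has_formal_sum
       (\<lambda>n m. x ^ n * (\<Sum>k=0..n. of_nat (n choose k) * (-1) ^ k *
                 generic_dfps_eval (of_real lam) (y + z * of_nat k) m))
       (\<lambda>m. \<Sum>p=0..m. of_nat (m choose p) * dfall (of_real lam) (m - p) y * z ^ p *
                 dfubini (of_real lam / z) p (- x)) \<and>
     has_formal_sum
       (\<lambda>n m. x ^ n * (\<Sum>k=0..n. of_nat (n choose k) * (-1) ^ k *
                 generic_dfps_eval (of_real lam) (z * of_nat k) m))
       (\<lambda>m. z ^ m * dfubini (of_real lam / z) m (- x)) \<and>
     has_formal_sum
       (\<lambda>n m. x ^ n * (\<Sum>k=0..n. of_nat (n choose k) * (-1) ^ k *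
                 dfps_eval a (of_real lam) (y + z * of_nat k) m))
       (\<lambda>m. a m * (\<Sum>p=0..m. of_nat (m choose p) * dfall (of_real lam) (m - p) y * z ^ p *
                 dfubini (of_real lam / z) p (- x))) \<and>
     has_formal_sum
       (\<lambda>n m. x ^ n * (\<Sum>k=0..n. of_nat (n choose k) * (-1) ^ k *
                 dfps_eval a (of_real lam) (z * of_nat k) m))
       (\<lambda>m. a m * z ^ m * dfubini (of_real lam / z) m (- x))"
proof -
  let ?l = "of_real lam :: complex"
  have y0: "(\<Sum>p=0..m. of_nat (m choose p) * dfall ?l (m - p) 0 * z ^ p * dfubini (?l / z) p (- x)) =
      z ^ m * dfubini (?l / z) m (- x)" for m
  proof -
    have "(\<Sum>p=0..m. of_nat (m choose p) * dfall ?l (m - p) 0 * z ^ p * dfubini (?l / z) p (- x)) =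
        (\<Sum>p=0..m. if p = m then z ^ m * dfubini (?l / z) m (- x) else 0)"
      by (intro sum.cong) (auto simp: dfall_at_0)
    then show ?thesis by simp
  qed
  note main = has_formal_sum_binomial_difference[OF assms, where \<mu> = ?l and x = x]
  show ?thesis
    using main[of "\<lambda>_. 1" y] main[of "\<lambda>_. 1" 0] main[of a y] main[of a 0]
    unfolding y0 generic_dfps_eval_def dfps_eval_def by (simp only: mult_1_left add_0_left mult.assoc)
qed

end
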